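(* Let $f(X)=a_0+a_1X+\cdots+a_nX^n$ be an Eneström–Kakeya polynomial of degree $n$ with integer coefficients, $a_0\neq 0$, and $a,b$ two integers with $a^2<b^2$ and $|a+b|>2$. Then $f$ is irreducible over $\mathbb{Q}$ in each of the following cases: (i) $|f(a)|=p^kr$, $|f(b)|=p^{k+1}$ with $p$ prime and integers $k,r$ with $k\ge 0$ and $0<r<p$; (ii) $|f(a)|=p^k$, $|f(b)|=p^kr$ for some primes $p,r$ with $r<p$ and some integer $k\ge 1$.
   Context: A polynomial $f(X)=a_0+a_1X+\cdots+a_nX^n$ with real coefficients is called an Eneström–Kakeya polynomial if $0\le a_0\le a_1\le\cdots\le a_n$. *)

theory Defs
  imports Complex_Main "HOL-Computational_Algebra.Computational_Algebra"
begin

definition enestrom_kakeya :: "real poly \<Rightarrow> bool" where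
  "enestrom_kakeya f \<longleftrightarrow>
     0 \<le> coeff f 0 \<and> (\<forall>i<degree f. coeff f i \<le> coeff f (Suc i))"

end

theory Submission
  imports Defs "Berlekamp_Zassenhaus.Factor_Bound"
begin

text \<open>
  By Enestrom and Kakeya all complex roots of \<open>f\<close> lie in the closed unit disc. The hypotheses on
  \<open>a\<close> and \<open>b\<close> put every point of that disc strictly closer to \<open>a\<close> than to \<open>b\<close>, so every
  nonconstant integer factor \<open>g\<close> of \<open>f\<close> satisfies \<open>\<bar>g(a)\<bar> < \<bar>g(b)\<bar>\<close>. For a proper factorization
  \<open>f = g h\<close>, which may be taken over the integers by Gauss' lemma, these two strict inequalities
  contradict the way \<open>p\<close> divides \<open>f(a) = g(a) h(a)\<close> and \<open>f(b) = g(b) h(b)\<close>.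
\<close>

hide_const (open) up_ring.coeff module.smult Divisibility.irreducible

text \<open>Abel summation: the factor \<open>1 - z\<close> trades coefficients for their successive
  differences, whose signs are known when the coefficients increase.\<close>

lemma one_minus_times_power_sum:
  fixes c :: "nat \<Rightarrow> 'a :: comm_ring_1"
  shows "(1 - z) * (\<Sum>i\<le>n. c i * z ^ i) =
    c 0 + (\<Sum>i<n. (c (Suc i) - c i) * z ^ Suc i) - c n * z ^ Suc n"
proof (induction n)
  case (Suc n)
  thus ?case
    by (simp add: distrib_left del: power_Suc) (simp add: algebra_simps)
qed (simp add: algebra_simps)

text \<open>At a root, Abel summation expresses c_n z^(n+1) through powers of exponent at most n,
  with nonnegative weights c_0 and c_(i+1) - c_i that add up to c_n. If |z| > 1, this bounds
  |z|^(n+1) by |z|^n.\<close>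

lemma enestrom_kakeya_root_bound:
  fixes p :: "real poly" and z :: complex
  assumes ek: "enestrom_kakeya p" and "p \<noteq> 0"
    and root: "poly (map_poly of_real p) z = 0"
  shows "norm z \<le> 1"
proof (rule ccontr)
  assume "\<not> norm z \<le> 1"
  hence z: "norm z > 1" by simp
  define n where "n = degree p"
  have mono: "coeff p i \<le> coeff p (Suc i)" if "i < n" for i
    using ek that by (auto simp: enestrom_kakeya_def n_def)
  have c0: "coeff p 0 \<ge> 0"
    using ek by (simp add: enestrom_kakeya_def)
  have "coeff p i \<ge> 0" if "i \<le> n" for i
    using that by (induction i) (use c0 mono in \<open>auto intro: order_trans\<close>)
  hence lead: "coeff p n > 0"
    using \<open>p \<noteq> 0\<close> by (metis leading_coeff_0_iff n_def order.refl order_le_less)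
  have "(\<Sum>i\<le>n. of_real (coeff p i) * z ^ i) = 0"
    using root by (simp add: poly_altdef n_def)
  hence "of_real (coeff p n) * z ^ Suc n =
      of_real (coeff p 0) + (\<Sum>i<n. (of_real (coeff p (Suc i)) - of_real (coeff p i)) * z ^ Suc i)"
    using one_minus_times_power_sum[of z "\<lambda>i. of_real (coeff p i)" n] by simp
  hence "coeff p n * norm z ^ Suc n =
      norm (of_real (coeff p 0) + (\<Sum>i<n. of_real (coeff p (Suc i) - coeff p i) * z ^ Suc i))"
    using lead by (metis (no_types, lifting) abs_of_pos norm_mult norm_of_real norm_power
        of_real_diff sum.cong)
  also have "\<dots> \<le> coeff p 0 + (\<Sum>i<n. norm (of_real (coeff p (Suc i) - coeff p i) * z ^ Suc i))"
    using c0 by (intro order_trans[OF norm_triangle_ineq] add_mono sum_norm_le) auto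
  also have "\<dots> = coeff p 0 + (\<Sum>i<n. (coeff p (Suc i) - coeff p i) * norm z ^ Suc i)"
    using mono by (intro arg_cong2[of _ _ _ _ "(+)"] sum.cong refl)
      (simp only: norm_mult norm_of_real norm_power, simp)
  \<comment> \<open>Every exponent is raised to n, so that the weights share one factor and their
    sum telescopes.\<close>
  also have "\<dots> \<le> coeff p 0 * norm z ^ n + (\<Sum>i<n. (coeff p (Suc i) - coeff p i) * norm z ^ n)"
    using z c0 mono
    by (intro add_mono sum_mono mult_left_mono power_increasing mult_right_mono)
      (auto simp: mult_le_cancel_left1 one_le_power)
  also have "\<dots> = coeff p n * norm z ^ n"
    by (simp only: sum_distrib_right[symmetric] sum_lessThan_telescope) (simp add: algebra_simps)
  finally have "norm z ^ Suc n \<le> norm z ^ n"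
    using lead by simp
  moreover have "norm z ^ n < norm z ^ Suc n"
    using z by (rule power_strict_increasing[OF lessI])
  ultimately show False by simp
qed

text \<open>Over the complex numbers, |p(x)| is |lead_coeff p| times the product of the distances
  from x to the roots; the products for \<open>a\<close> and \<open>b\<close> are compared factor by
  factor.\<close>

lemma norm_poly_less:
  fixes p :: "complex poly"
  assumes "degree p > 0"
    and closer: "\<And>z. poly p z = 0 \<Longrightarrow> norm (a - z) < norm (b - z)"
  shows "norm (poly p a) < norm (poly p b)"
proof -
  obtain root where p: "smult (lead_coeff p) (\<Prod>i<degree p. [:- root i, 1:]) = p"
    by (rule complex_poly_decompose')
  have poly: "poly p x = lead_coeff p * (\<Prod>i<degree p. x - root i)" for x
    by (subst p[symmetric]) (simp add: poly_prod)
  have "norm (a - root i) < norm (b - root i)" if "i < degree p" for i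
    using that by (intro closer) (auto simp: poly)
  \<comment> \<open>A distance from \<open>a\<close> may be zero, so a strict inequality of products
    needs all distances from \<open>b\<close> to be positive.\<close>
  moreover from this have "norm (b - root i) > 0" if "i < degree p" for i
    using that by (meson norm_ge_zero order_le_less_trans)
  ultimately have "(\<Prod>i<degree p. norm (a - root i)) < (\<Prod>i<degree p. norm (b - root i))"
    using \<open>degree p > 0\<close> by (intro prod_mono_strict[of 0]) (auto intro: less_imp_le)
  moreover have "lead_coeff p \<noteq> 0"
    using \<open>degree p > 0\<close> by auto
  ultimately show ?thesis
    by (simp add: poly norm_mult prod_norm)
qed

text \<open>The squared distances differ by (b - a)(b + a - 2 Re z). Since |2 Re z| <= 2 < |a + b|,
  the second factor has the sign of a + b, and (b - a)(b + a) > 0.\<close>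

lemma closer_to_unit_disc:
  fixes a b :: real and z :: complex
  assumes "a\<^sup>2 < b\<^sup>2" and "\<bar>a + b\<bar> > 2" and "norm z \<le> 1"
  shows "norm (of_real a - z) < norm (of_real b - z)"
proof -
  have "\<bar>Re z\<bar> \<le> 1"
    using abs_Re_le_cmod[of z] \<open>norm z \<le> 1\<close> by linarith
  moreover have "(b - a) * (b + a) > 0"
    using \<open>a\<^sup>2 < b\<^sup>2\<close> by (simp add: power2_eq_square algebra_simps)
  ultimately have "(b - a) * (b + a - 2 * Re z) > 0"
    using \<open>\<bar>a + b\<bar> > 2\<close> unfolding zero_less_mult_iff by linarith
  hence "(norm (of_real a - z))\<^sup>2 < (norm (of_real b - z))\<^sup>2"
    unfolding cmod_power2 by (simp add: power2_eq_square algebra_simps)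
  thus ?thesis
    by (rule power2_less_imp_less) simp
qed

text \<open>Here X = p^i and Y = p^j with i + j = k + 1. The bounds x < p^i and y < p^j leave x and
  y at most i - 1 and j - 1 factors p, so p^k cannot divide x y.\<close>

lemma prime_power_mult_contradiction:
  fixes p x y X Y :: int
  assumes "prime p" and "0 < r" and pos: "0 < x" "0 < y" and "0 < X" "0 < Y"
    and "x < X" "y < Y" and xy: "x * y = p ^ k * r" and XY: "X * Y = p ^ (k + 1)"
  shows False
proof -
  obtain i where X: "X = p ^ i"
    using divides_primepow[OF \<open>prime p\<close>, of X "k + 1"] XY \<open>0 < X\<close> by (metis dvd_triv_left abs_of_pos normalize_int_def)
  obtain j where Y: "Y = p ^ j"
    using divides_primepow[OF \<open>prime p\<close>, of Y "k + 1"] XY \<open>0 < Y\<close> by (metis dvd_triv_right abs_of_pos normalize_int_def)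
  have "i + j = k + 1"
    using XY prime_power_inj[OF \<open>prime p\<close>] unfolding X Y power_add[symmetric] by blast
  have p1: "p > 1"
    using \<open>prime p\<close> by (rule prime_gt_1_int)
  have bound: "multiplicity p w < m" if "0 < w" "w < p ^ m" for w :: int and m
  proof -
    have "p ^ multiplicity p w \<le> w"
      using that by (intro zdvd_imp_le multiplicity_dvd)
    with that have "p ^ multiplicity p w < p ^ m" by linarith
    thus ?thesis using p1 by simp
  qed
  have "k \<le> multiplicity p (x * y)"
    using p1 pos xy by (intro multiplicity_geI) auto
  also have "\<dots> = multiplicity p x + multiplicity p y"
    using \<open>prime p\<close> pos by (intro prime_elem_multiplicity_mult_distrib prime_imp_prime_elem) auto
  finally show False
    using bound[of x i] bound[of y j] pos \<open>x < X\<close> \<open>y < Y\<close> \<open>i + j = k + 1\<close> X Y by simp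
qed

text \<open>Both x and y are powers of p, while X and Y are p^i and r p^j in some order, with i + j
  = k. An exponent below p^i is at most i - 1; one below r p^j < p^(j+1) is at most j. The total
  falls short of k.\<close>

lemma prime_power_mult_prime_contradiction:
  fixes p r x y X Y :: int
  assumes "prime p" "prime r" "r < p" and "0 < x" "0 < y" and "0 < X" "0 < Y"
    and "x < X" "y < Y" and xy: "x * y = p ^ k" and XY: "X * Y = p ^ k * r"
  shows False
proof -
  have p1: "p > 1" and r1: "r > 1"
    using assms by (simp_all add: prime_gt_1_int)
  \<comment> \<open>Fresh variables allow the two factors to be swapped, according to which of
    \<open>X\<close>, \<open>Y\<close> is divisible by \<open>r\<close>.\<close>
  have *: False if pos: "0 < u" "0 < v" "0 < U" "0 < V" and less: "u < U" "v < V"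
    and uv: "u * v = p ^ k" and UV: "U * V = p ^ k * r" and "r dvd V" for u v U V :: int
  proof -
    obtain W where V: "V = r * W"
      using \<open>r dvd V\<close> by blast
    have UW: "U * W = p ^ k"
      using UV r1 by (simp add: V mult_ac)
    have "W > 0"
      using \<open>0 < V\<close> r1 by (simp add: V zero_less_mult_iff)
    have pow: "\<exists>m. w = p ^ m" if "0 < w" "w dvd p ^ k" for w
      using divides_primepow[OF \<open>prime p\<close> that(2)] that(1) by (metis abs_of_pos normalize_int_def)
    obtain s t i j where eq: "u = p ^ s" "v = p ^ t" "U = p ^ i" "W = p ^ j"
      using pow[of u] pow[of v] pow[of U] pow[of W] pos \<open>W > 0\<close> uv UW
      by (metis dvd_triv_left dvd_triv_right)
    have "s + t = i + j"
      using uv UW p1 unfolding eq by (metis power_add power_inject_exp)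
    moreover have "s < i"
      using less(1) p1 by (simp add: eq)
    moreover have "p ^ t < p ^ Suc j"
    proof -
      have "p ^ t < r * p ^ j" using less(2) by (simp add: V eq)
      also have "\<dots> < p * p ^ j" using \<open>r < p\<close> p1 by simp
      finally show ?thesis by simp
    qed
    hence "t < Suc j" using p1 by (simp only: power_strict_increasing_iff)
    ultimately show False by linarith
  qed
  have "r dvd X * Y" by (simp add: XY)
  hence "r dvd X \<or> r dvd Y"
    using \<open>prime r\<close> by (simp add: prime_dvd_mult_iff)
  thus False
    using *[of x y X Y] *[of y x Y X] assms by (auto simp: mult.commute)
qed

theorem corollary1p6:
  fixes f :: "int poly" and n :: nat and a b :: int
  assumes "enestrom_kakeya (map_poly real_of_int f)"
    and "degree f = n"
    and "coeff f 0 \<noteq> 0"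
    and "a\<^sup>2 < b\<^sup>2"
    and "\<bar>a + b\<bar> > 2"
    and "(\<exists>(p::int) (k::nat) (r::int). prime p \<and> 0 < r \<and> r < p \<and>
            \<bar>poly f a\<bar> = p ^ k * r \<and> \<bar>poly f b\<bar> = p ^ (k + 1))
       \<or> (\<exists>(p::int) (k::nat) (r::int). prime p \<and> prime r \<and> r < p \<and> k \<ge> 1 \<and>
            \<bar>poly f a\<bar> = p ^ k \<and> \<bar>poly f b\<bar> = p ^ k * r)"
  shows "irreducible (map_poly rat_of_int f)"
proof -
  have fa: "poly f a \<noteq> 0"
    using assms(6) by (auto dest: prime_gt_0_int)
  have f0: "f \<noteq> 0"
    using assms(3) by auto
  have growth: "\<bar>poly g a\<bar> < \<bar>poly g b\<bar>" if "g dvd f" "degree g > 0" for g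
  proof -
    have eval: "poly (map_poly of_int g) (of_real (of_int x)) = (of_int (poly g x) :: complex)" for x
      by simp
    have "norm (poly (map_poly of_int g) (of_real (of_int a)) :: complex) <
          norm (poly (map_poly of_int g) (of_real (of_int b)) :: complex)"
    proof (rule norm_poly_less)
      show "degree (map_poly of_int g :: complex poly) > 0"
        using that by simp
    next
      fix z :: complex
      assume "poly (map_poly of_int g) z = 0"
      hence "poly (map_poly of_int f) z = 0"
        using \<open>g dvd f\<close> by (auto simp: hom_distribs elim!: dvdE)
      \<comment> \<open>The root bound concerns real polynomials, so the embedding of the integers
        into the complex numbers is factored through the reals.\<close>
      moreover have "map_poly of_int f = map_poly complex_of_real (map_poly real_of_int f)"
        by (simp add: map_poly_map_poly o_def)
      ultimately have "norm z \<le> 1"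
        using f0 by (intro enestrom_kakeya_root_bound[OF assms(1)]) auto
      moreover have "(real_of_int a)\<^sup>2 < (real_of_int b)\<^sup>2" "\<bar>real_of_int a + real_of_int b\<bar> > 2"
        using assms(4,5) by (metis of_int_less_iff of_int_power) (use assms(5) in linarith)
      ultimately show "norm (complex_of_real (of_int a) - z) < norm (complex_of_real (of_int b) - z)"
        by (intro closer_to_unit_disc) auto
    qed
    thus ?thesis
      unfolding eval by simp
  qed
  have no_factors: False if f: "f = g * h" and deg: "degree g > 0" "degree h > 0" for g h
  proof -
    have less: "\<bar>poly g a\<bar> < \<bar>poly g b\<bar>" "\<bar>poly h a\<bar> < \<bar>poly h b\<bar>"
      using growth deg by (simp_all add: f)
    have pos: "0 < \<bar>poly g a\<bar>" "0 < \<bar>poly h a\<bar>"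
      using fa by (simp_all add: f)
    have abs: "\<bar>poly f x\<bar> = \<bar>poly g x\<bar> * \<bar>poly h x\<bar>" for x
      by (simp add: f abs_mult)
    show False
      using assms(6) unfolding abs
      using prime_power_mult_contradiction[of _ _ "\<bar>poly g a\<bar>" "\<bar>poly h a\<bar>" "\<bar>poly g b\<bar>" "\<bar>poly h b\<bar>"]
        prime_power_mult_prime_contradiction[of _ _ "\<bar>poly g a\<bar>" "\<bar>poly h a\<bar>" "\<bar>poly g b\<bar>" "\<bar>poly h b\<bar>"]
        less pos less_trans[OF pos(1) less(1)] less_trans[OF pos(2) less(2)] by blast
  qed
  \<comment> \<open>A constant would give |f(a)| = |f(b)|, forcing r = p in the first case and r = 1
    in the second.\<close>
  have "degree f > 0"
  proof (rule ccontr)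
    assume "\<not> degree f > 0"
    then obtain c where "f = [:c:]"
      using degree_eq_zeroE by blast
    hence eq: "\<bar>poly f a\<bar> = \<bar>poly f b\<bar>" by simp
    show False
      using assms(6) unfolding eq by (auto dest: prime_gt_1_int prime_gt_0_int)
  qed
  show ?thesis
  proof (rule irreducibleI)
    show "map_poly rat_of_int f \<noteq> 0" using f0 by simp
    show "\<not> is_unit (map_poly rat_of_int f)"
      using \<open>degree f > 0\<close> f0 by (simp add: is_unit_iff_degree)
    fix G H assume GH: "map_poly rat_of_int f = G * H"
    \<comment> \<open>Gauss' lemma preserves the degrees, and these suffice: the units over the
      rationals are the nonzero constants.\<close>
    then obtain g h where "f = g * h" "degree g = degree G" "degree h = degree H"
      using rat_to_int_factor by blast
    with no_factors have "degree G = 0 \<or> degree H = 0" by (metis neq0_conv)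
    moreover have "G \<noteq> 0" "H \<noteq> 0" using GH f0 by auto
    ultimately show "is_unit G \<or> is_unit H"
      by (simp add: is_unit_iff_degree)
  qed
qed

end
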